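(* For $d=2$, the set of values $\{\hat{\hat\omega}(\Lambda) : \Lambda \text{ a full-rank lattice in } \mathbb{R}^2\}$ is exactly $[0,\infty]$.
   Context: For $\vec z=(z_1,\ldots,z_d)\in\mathbb{R}^d$ let $|\vec z|=\max_{1\le i\le d}|z_i|$ and $\Pi(\vec z)=\prod_{i=1}^d|z_i|^{1/d}$. For $\boldsymbol\lambda=(\lambda_1,\ldots,\lambda_d)\in\mathbb{R}_{>0}^d$ let $\mathcal{P}(\boldsymbol\lambda)=\{\vec z\in\mathbb{R}^d : |z_i|\le\lambda_i,\ i=1,\ldots,d\}$. For a full-rank lattice $\Lambda\subset\mathbb{R}^d$, the weak uniform Diophantine exponent $\hat{\hat\omega}(\Lambda)$ is the supremum of real numbers $\gamma$ such that for every sufficiently large $t$ there exists $\boldsymbol\lambda\in\mathbb{R}_{>0}^d$ with $|\boldsymbol\lambda|\le t$ and $\Pi(\boldsymbol\lambda)\le t^{-\gamma}$ such that $\mathcal{P}(\boldsymbol\lambda)$ contains a nonzero point of $\Lambda$ (the value $+\infty$ is allowed). *)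

theory Defs
  imports "HOL-Analysis.Analysis"
begin

definition full_rank_lattice :: "(real ^ 'd) set \<Rightarrow> bool" where
  "full_rank_lattice \<Lambda> \<longleftrightarrow>
     (\<exists>B. independent B \<and> span B = UNIV \<and>
          \<Lambda> = {\<Sum>b\<in>B. real_of_int (c b) *\<^sub>R b | c. True})"

definition geom_mean_abs :: "real ^ 'd \<Rightarrow> real" where
  "geom_mean_abs z = (\<Prod>i\<in>UNIV. \<bar>z $ i\<bar> powr (1 / real CARD('d)))"

definition parallelepiped :: "real ^ 'd \<Rightarrow> (real ^ 'd) set" where
  "parallelepiped l = {z. \<forall>i. \<bar>z $ i\<bar> \<le> l $ i}"

text \<open>The maximum norm is the library's \<^const>\<open>infnorm\<close>, by the following fact.\<close>

lemma infnorm_eq_Max: "infnorm (z :: real ^ 'd) = Max (range (\<lambda>i. \<bar>z $ i\<bar>))"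
proof -
  have "{\<bar>z $ i\<bar> | i. i \<in> UNIV} = range (\<lambda>i. \<bar>z $ i\<bar>)"
    by auto
  then show ?thesis
    by (simp add: infnorm_cart cSup_eq_Max)
qed

text \<open>The supremum is taken in the extended reals, so that the value \<open>\<infinity>\<close> is possible.\<close>

definition weak_uniform_exponent :: "(real ^ 'd) set \<Rightarrow> ereal" where
  "weak_uniform_exponent \<Lambda> =
     Sup {ereal \<gamma> | \<gamma>.
       \<forall>\<^sub>F t in at_top. \<exists>l :: real ^ 'd.
         (\<forall>i. 0 < l $ i) \<and> infnorm l \<le> t \<and> geom_mean_abs l \<le> t powr (- \<gamma>) \<and>
         (\<exists>z \<in> parallelepiped l \<inter> \<Lambda>. z \<noteq> 0)}"

end

theory Submission
  imports Defs
begin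

text \<open>
  A nonzero point \<open>z\<close> lies in an admissible box for \<open>t\<close> iff \<open>|z| \<le> t\<close> and \<open>|z\<^sub>1 z\<^sub>2| \<le> t powr (- 2\<gamma>)\<close>.
  A single fixed \<open>z\<close> therefore shows that the exponent is at least 0, and a lattice point on a
  coordinate axis makes it infinite. For finite \<open>\<gamma> \<ge> 0\<close> consider the lattice of the points
  \<open>(m - \<alpha> n, n - \<beta> m)\<close>, where the continued fraction denominators of \<open>\<alpha>\<close> and \<open>\<beta>\<close> interlace: they
  are the terms of even and of odd index of one increasing sequence \<open>X\<close> in which
  \<open>X (k + 2) / X k\<close> is comparable to \<open>X (k + 1) powr (2\<gamma>)\<close>. The convergent with denominator \<open>X k\<close>
  gives a lattice point of size about \<open>X k\<close> and product about \<open>X k / X (k + 2)\<close>, hence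
  about \<open>X (k + 1) powr (- 2\<gamma>)\<close>, which serves all \<open>t\<close> up to the size of the next such point,
  and no point of size below \<open>X (k + 1) / 4\<close> has an essentially smaller product.
\<close>

section \<open>Real numbers with prescribed continued fraction denominators\<close>

text \<open>The intervals of radius \<open>2 * e j\<close> around \<open>x j\<close> are nested,
  because a step of at most \<open>e j\<close> and the halved radius fit together; \<open>L\<close>
  is a common point. The explicit error, beyond mere convergence, is what the approximation
  estimates need.\<close>

lemma nested_limit:
  fixes x e :: "nat \<Rightarrow> real"
  assumes step: "\<And>j. \<bar>x (Suc j) - x j\<bar> \<le> e j"
    and half: "\<And>j. 2 * e (Suc j) \<le> e j"
  obtains L where "\<And>j. \<bar>L - x j\<bar> \<le> 2 * e j"
proof -
  define lo where "lo j = x j - 2 * e j" for j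
  define hi where "hi j = x j + 2 * e j" for j
  have "incseq lo"
  proof (rule incseq_SucI)
    show "lo j \<le> lo (Suc j)" for j
      using step[of j] half[of j] by (simp add: lo_def)
  qed
  have "decseq hi"
  proof (rule decseq_SucI)
    show "hi (Suc j) \<le> hi j" for j
      using step[of j] half[of j] by (simp add: hi_def)
  qed
  have "e j \<ge> 0" for j
    using step[of j] by linarith
  then have lo_hi: "lo j \<le> hi j" for j
    by (simp add: lo_def hi_def)
  have cross: "lo i \<le> hi j" for i j
    using incseqD[OF \<open>incseq lo\<close>, of i "max i j"] decseqD[OF \<open>decseq hi\<close>, of j "max i j"]
      lo_hi[of "max i j"] by simp
  have "bdd_above (range lo)"
    using cross[of _ 0] by (intro bdd_aboveI[of _ "hi 0"]) auto
  then have "lo j \<le> Sup (range lo)" for j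
    by (simp add: cSUP_upper)
  moreover have "Sup (range lo) \<le> hi j" for j
    using cross by (intro cSUP_least) auto
  ultimately have "\<bar>Sup (range lo) - x j\<bar> \<le> 2 * e j" for j
    unfolding lo_def hi_def by (smt (verit, best))
  then show ?thesis by (rule that)
qed

text \<open>Numerators of the convergents of [0; \<open>q 1\<close>, \<open>b 0\<close>,
  \<open>b 1\<close>, ...] when the denominators \<open>q\<close> obey the same recursion with
  \<open>q 0 = 1\<close>. Thus \<open>q 1\<close> is the first partial quotient and
  \<open>b j\<close> the one of index \<open>j + 2\<close>.\<close>

fun convergent_num :: "(nat \<Rightarrow> int) \<Rightarrow> nat \<Rightarrow> int" where
  "convergent_num b 0 = 0"
| "convergent_num b (Suc 0) = 1"
| "convergent_num b (Suc (Suc j)) = b j * convergent_num b (Suc j) + convergent_num b j"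

lemma convergent_det:
  assumes "q 0 = 1" and rec: "\<And>j. q (Suc (Suc j)) = b j * q (Suc j) + q j"
  shows "convergent_num b (Suc j) * q j - convergent_num b j * q (Suc j) = (- 1) ^ j"
proof (induction j)
  case 0
  then show ?case using assms by simp
next
  case (Suc j)
  have "convergent_num b (Suc (Suc j)) * q (Suc j) - convergent_num b (Suc j) * q (Suc (Suc j))
      = - (convergent_num b (Suc j) * q j - convergent_num b j * q (Suc j))"
    by (simp add: rec algebra_simps)
  then show ?case using Suc by simp
qed

text \<open>The number is the limit of the convergents. By the determinant identity consecutive ones
  differ by exactly \<open>e j\<close>, and the growth of \<open>q\<close> makes these gaps at least
  halve, so \<open>nested_limit\<close> applies; its factor 2 survives in the error bound.\<close>

lemma number_with_denominators:
  fixes q b :: "nat \<Rightarrow> int"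
  assumes q0: "q 0 = 1" and grow: "\<And>j. 8 * q j \<le> q (Suc j)"
    and rec: "\<And>j. q (Suc (Suc j)) = b j * q (Suc j) + q j"
  obtains \<alpha> :: real and p :: "nat \<Rightarrow> int"
  where "\<And>j. \<bar>p j - \<alpha> * q j\<bar> \<le> 2 / q (Suc j)" and "p 0 = 0"
    and "\<And>j. coprime (p j) (q j)"
proof -
  define p where "p = convergent_num b"
  have pos: "q j > 0" for j
  proof (induction j)
    case (Suc j)
    then show ?case using grow[of j] by linarith
  qed (simp add: q0)
  have det: "p (Suc j) * q j - p j * q (Suc j) = (- 1) ^ j" for j
    unfolding p_def using q0 rec by (rule convergent_det)
  define x where "x j = real_of_int (p j) / q j" for j
  define e where "e j = 1 / (real_of_int (q j) * q (Suc j))" for j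
  have step: "\<bar>x (Suc j) - x j\<bar> \<le> e j" for j
  proof -
    have "x (Suc j) - x j = real_of_int (p (Suc j) * q j - p j * q (Suc j)) / (real_of_int (q j) * q (Suc j))"
      using pos[of j] pos[of "Suc j"] by (simp add: x_def field_simps)
    also have "\<bar>\<dots>\<bar> = e j"
      unfolding det e_def using pos[of j] pos[of "Suc j"] by (simp add: abs_mult)
    finally show ?thesis by simp
  qed
  have half: "2 * e (Suc j) \<le> e j" for j
  proof -
    have "2 * q j \<le> q (Suc (Suc j))"
      using grow[of j] grow[of "Suc j"] pos[of j] by linarith
    then have "2 * real_of_int (q j) \<le> q (Suc (Suc j))" by linarith
    then show ?thesis
      using pos[of j] pos[of "Suc j"] pos[of "Suc (Suc j)"] by (simp add: e_def field_simps)
  qed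
  obtain \<alpha> where \<alpha>: "\<And>j. \<bar>\<alpha> - x j\<bar> \<le> 2 * e j"
    using nested_limit[of x e] step half by blast
  have "\<bar>p j - \<alpha> * q j\<bar> \<le> 2 / q (Suc j)" for j
  proof -
    have "p j - \<alpha> * q j = - (q j * (\<alpha> - x j))"
      using pos[of j] by (simp add: x_def field_simps)
    then have "\<bar>p j - \<alpha> * q j\<bar> = q j * \<bar>\<alpha> - x j\<bar>"
      using pos[of j] by (simp add: abs_mult)
    also have "\<dots> \<le> q j * (2 * e j)"
      using \<alpha> pos[of j] by (intro mult_left_mono) auto
    also have "\<dots> = 2 / q (Suc j)"
      using pos[of j] by (simp add: e_def)
    finally show ?thesis .
  qed
  moreover have "coprime (p j) (q j)" for j
  proof (rule coprimeI)
    fix c assume "c dvd p j" "c dvd q j"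
    then have "c dvd p (Suc j) * q j - p j * q (Suc j)" by simp
    then show "is_unit c"
      unfolding det by (metis dvd_trans dvd_refl minus_one_power_iff dvd_minus_iff)
  qed
  ultimately show ?thesis by (intro that[of p \<alpha>]) (auto simp: p_def)
qed

text \<open>A crude best approximation law. As \<open>p / q\<close> is reduced and 0 < |n| < q, the
  integer \<open>m * q - n * p\<close> is nonzero, so its absolute value is at least 1. The next
  denominator \<open>q'\<close> is so large that replacing \<open>p / q\<close> by \<alpha> costs at
  most 1/4.\<close>

lemma denominators_lower_bound:
  fixes m n p q q' :: int and \<alpha> :: real
  assumes "coprime p q" "0 < \<bar>n\<bar>" "\<bar>n\<bar> < q" and approx: "\<bar>p - \<alpha> * q\<bar> \<le> 2 / q'"
    and "8 * q \<le> q'"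
  shows "1 / (2 * q) \<le> \<bar>m - \<alpha> * n\<bar>"
proof -
  have "m * q - n * p \<noteq> 0"
  proof
    assume "m * q - n * p = 0"
    then have "q dvd n * p" by (metis dvd_triv_right eq_iff_diff_eq_0)
    then have "q dvd n"
      using assms(1) by (simp add: coprime_commute coprime_dvd_mult_left_iff)
    then show False
      using assms(2,3) dvd_imp_le_int[of n q] by auto
  qed
  then have "1 \<le> \<bar>m * q - n * p\<bar>" by linarith
  then have "1 \<le> \<bar>real_of_int (m * q - n * p)\<bar>" by linarith
  also have "real_of_int (m * q - n * p) = q * (m - \<alpha> * n) - n * (p - \<alpha> * q)"
    by (simp add: algebra_simps)
  also have "\<bar>\<dots>\<bar> \<le> q * \<bar>m - \<alpha> * n\<bar> + \<bar>n\<bar> * \<bar>p - \<alpha> * q\<bar>"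
    using abs_triangle_ineq4[of "q * (m - \<alpha> * n)" "n * (p - \<alpha> * q)"] assms(2,3)
    by (simp add: abs_mult)
  also have "\<bar>n\<bar> * \<bar>p - \<alpha> * q\<bar> \<le> q * (2 / q')"
    using assms by (intro mult_mono) auto
  also have "q * (2 / q') \<le> 1 / 4"
  proof -
    have "8 * real_of_int q \<le> q'" using assms(5) by linarith
    then show ?thesis using assms(2,3) by (simp add: field_simps)
  qed
  finally have "3 / 4 \<le> q * \<bar>m - \<alpha> * n\<bar>" by linarith
  then show ?thesis using assms(2,3) by (simp add: field_simps)
qed

section \<open>Two interlaced sequences of denominators\<close>

text \<open>The terms with even index are the denominators of one continued fraction, the terms with
  odd index those of another one; every partial quotient is determined by the last term of the
  other sequence.\<close>

fun interlaced :: "(int \<Rightarrow> int) \<Rightarrow> nat \<Rightarrow> int" where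
  "interlaced a 0 = 1"
| "interlaced a (Suc 0) = 1"
| "interlaced a (Suc (Suc 0)) = a 1"
| "interlaced a (Suc (Suc (Suc 0))) = a (a 1)"
| "interlaced a (Suc (Suc (Suc (Suc k)))) =
     a (interlaced a (Suc (Suc (Suc k)))) * interlaced a (Suc (Suc k)) + interlaced a k"

text \<open>The bound 8 is the growth factor demanded of each of the two sequences of denominators;
  monotonicity of \<open>a\<close> keeps the merged sequence increasing.\<close>

locale interlaced_denominators =
  fixes a :: "int \<Rightarrow> int"
  assumes a_ge: "\<And>x. x \<ge> 1 \<Longrightarrow> 8 \<le> a x"
    and a_mono: "\<And>x y. 1 \<le> x \<Longrightarrow> x \<le> y \<Longrightarrow> a x \<le> a y"
begin

abbreviation X :: "nat \<Rightarrow> int" where "X \<equiv> interlaced a"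

text \<open>The recursion reaches back four indices, so the induction has to carry a window of five
  terms: comparing the next two terms uses three of the older inequalities.\<close>

lemma X_window: "1 \<le> X k \<and> X k \<le> X (Suc k) \<and> X (Suc k) \<le> X (Suc (Suc k))
   \<and> X (Suc (Suc k)) \<le> X (Suc (Suc (Suc k)))
   \<and> X (Suc (Suc (Suc k))) \<le> X (Suc (Suc (Suc (Suc k))))"
proof (induction k)
  case 0
  have "a (a 1) \<le> a (a (a 1)) * a 1"
    using a_ge[of 1] a_ge[of "a 1"] a_mono[of "a 1" "a (a 1)"] a_mono[of 1 "a 1"]
      mult_mono[of "a (a 1)" "a (a (a 1))" 1 "a 1"] by simp
  then show ?case using a_ge[of 1] a_mono[of 1 "a 1"] by simp
next
  case (Suc k)
  have "a (X (Suc (Suc (Suc k)))) * X (Suc (Suc k))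
      \<le> a (X (Suc (Suc (Suc (Suc k))))) * X (Suc (Suc (Suc k)))"
  proof (rule mult_mono)
    have ge1: "1 \<le> X (Suc (Suc (Suc k)))" and le: "X (Suc (Suc (Suc k))) \<le> X (Suc (Suc (Suc (Suc k))))"
      using Suc by linarith+
    show "a (X (Suc (Suc (Suc k)))) \<le> a (X (Suc (Suc (Suc (Suc k)))))"
      using a_mono[OF ge1 le] .
    show "0 \<le> a (X (Suc (Suc (Suc (Suc k)))))"
      using a_ge[of "X (Suc (Suc (Suc (Suc k))))"] ge1 le by linarith
  qed (use Suc in linarith)+
  moreover have "X (Suc (Suc (Suc (Suc k)))) = a (X (Suc (Suc (Suc k)))) * X (Suc (Suc k)) + X k"
    "X (Suc (Suc (Suc (Suc (Suc k))))) =
      a (X (Suc (Suc (Suc (Suc k))))) * X (Suc (Suc (Suc k))) + X (Suc k)"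
    by (simp_all only: interlaced.simps)
  ultimately have "X (Suc (Suc (Suc (Suc k)))) \<le> X (Suc (Suc (Suc (Suc (Suc k)))))"
    using Suc by linarith
  then show ?case using Suc by linarith
qed

lemma X_ge_1: "1 \<le> X k"
  using X_window[of k] by simp

lemma X_mono: "i \<le> j \<Longrightarrow> X i \<le> X j"
  by (rule lift_Suc_mono_le[of X]) (use X_window in auto)

text \<open>The additive term of the recursion lies two places before \<open>X k\<close>, hence
  between 0 and \<open>X k\<close>; the first two instances have no such term.\<close>

lemma X_bounds: "a (X (Suc k)) * X k \<le> X (Suc (Suc k))"
  "X (Suc (Suc k)) \<le> (a (X (Suc k)) + 1) * X k"
proof -
  have "a (X (Suc k)) * X k \<le> X (Suc (Suc k)) \<and> X (Suc (Suc k)) \<le> (a (X (Suc k)) + 1) * X k"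
  proof -
    consider "k = 0" | "k = 1" | l where "k = Suc (Suc l)"
      by (metis One_nat_def not0_implies_Suc)
    then show ?thesis
    proof cases
      case (3 l)
      then show ?thesis using X_ge_1[of l] X_mono[of l k] by (simp add: algebra_simps)
    qed simp_all
  qed
  then show "a (X (Suc k)) * X k \<le> X (Suc (Suc k))"
    "X (Suc (Suc k)) \<le> (a (X (Suc k)) + 1) * X k" by auto
qed

lemma X_grow: "8 * X k \<le> X (Suc (Suc k))"
  using X_bounds(1)[of k] mult_right_mono[OF a_ge[OF X_ge_1[of "Suc k"]], of "X k"] X_ge_1[of k]
  by linarith

text \<open>Only unboundedness matters; this linear form makes it easy to find a term beyond a given
  real number.\<close>

lemma X_ge: "int k \<le> 2 * X k"
proof (induction k rule: less_induct)
  case (less k)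
  show ?case
  proof (cases "k < 2")
    case True
    then show ?thesis using X_ge_1[of k] by linarith
  next
    case False
    then have k: "k = Suc (Suc (k - 2))" by simp
    have "int (k - 2) \<le> 2 * X (k - 2)" using less.IH[of "k - 2"] False by linarith
    then have "int (k - 2) + 2 \<le> 2 * X (Suc (Suc (k - 2)))"
      using X_grow[of "k - 2"] X_ge_1[of "k - 2"] by linarith
    then show ?thesis using k False by simp
  qed
qed

text \<open>The parameter \<open>r\<close> selects the parity class. The last clause refers to the
  merged sequence, so it reads the same for both classes and they can later be treated
  symmetrically. It holds because |n| lies between consecutive denominators \<open>q j\<close> and
  \<open>q (Suc j)\<close>: the distance is at least \<open>1 / (2 * q (Suc j))\<close> and |n| is
  at least \<open>q j\<close>.\<close>

lemma approximable_number:
  assumes "r < 2"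
  obtains \<alpha> :: real where "\<bar>\<alpha>\<bar> \<le> 1 / 4"
    and "\<And>j. \<exists>p :: int. \<bar>p - \<alpha> * X (2 * j + r)\<bar> \<le> 2 / X (2 * j + r + 2)"
    and "\<And>(m :: int) (n :: int) k. 0 < \<bar>n\<bar> \<Longrightarrow> \<bar>n\<bar> < X (Suc k) \<Longrightarrow>
           \<exists>i\<le>k. X i / (2 * real_of_int (X (i + 2))) \<le> \<bar>n\<bar> * \<bar>m - \<alpha> * n\<bar>"
proof -
  define q where "q j = X (2 * j + r)" for j
  have qSuc: "q (Suc j) = X (2 * j + r + 2)" for j
    by (simp add: q_def)
  have q0: "q 0 = 1"
    using assms by (auto simp: q_def less_2_cases_iff)
  have grow: "8 * q j \<le> q (Suc j)" for j
    using X_grow[of "2 * j + r"] by (simp add: q_def)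
  \<comment> \<open>Read with stride two, the recursion has the three-term shape of continued
    fraction denominators; the partial quotient depends on a term of the other class.\<close>
  have rec: "q (Suc (Suc j)) = a (X (2 * j + r + 3)) * q (Suc j) + q j" for j
    by (simp add: q_def numeral_3_eq_3)
  obtain \<alpha> :: real and p :: "nat \<Rightarrow> int" where \<alpha>: "\<And>j. \<bar>p j - \<alpha> * q j\<bar> \<le> 2 / q (Suc j)" and p0: "p 0 = 0"
    and cop: "\<And>j. coprime (p j) (q j)"
    using number_with_denominators[OF q0 grow rec] by metis
  have "\<bar>\<alpha>\<bar> \<le> 1 / 4"
  proof -
    have "8 \<le> q 1" using grow[of 0] q0 by simp
    then have "2 / real_of_int (q 1) \<le> 1 / 4" by (simp add: field_simps)
    \<comment> \<open>The zeroth convergent is 0/1, so its error is \<alpha> itself.\<close>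
    then show ?thesis using \<alpha>[of 0] p0 q0 by simp
  qed
  moreover have "\<exists>p :: int. \<bar>p - \<alpha> * X (2 * j + r)\<bar> \<le> 2 / X (2 * j + r + 2)" for j
    using \<alpha>[of j] unfolding qSuc by (auto simp: q_def)
  moreover have "\<exists>i\<le>k. X i / (2 * real_of_int (X (i + 2))) \<le> \<bar>n\<bar> * \<bar>m - \<alpha> * n\<bar>"
    if n: "0 < \<bar>n\<bar>" "\<bar>n\<bar> < X (Suc k)" for m n :: int and k
  proof -
    have ex: "\<exists>j. \<bar>n\<bar> < q (Suc j)"
    proof
      have "X (Suc k) \<le> q (Suc k)" unfolding q_def by (rule X_mono) simp
      then show "\<bar>n\<bar> < q (Suc k)" using n by linarith
    qed
    define j where "j = (LEAST j. \<bar>n\<bar> < q (Suc j))"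
    have up: "\<bar>n\<bar> < q (Suc j)"
      unfolding j_def using ex by (rule LeastI_ex)
    have lo: "q j \<le> \<bar>n\<bar>"
    proof (cases j)
      case 0
      then show ?thesis using q0 n by simp
    next
      case (Suc l)
      then show ?thesis using not_less_Least[of l "\<lambda>j. \<bar>n\<bar> < q (Suc j)"] by (simp add: j_def)
    qed
    have "2 * j + r \<le> k"
    proof (rule ccontr)
      assume "\<not> 2 * j + r \<le> k"
      then have "X (Suc k) \<le> q j" unfolding q_def by (intro X_mono) simp
      then show False using lo n by linarith
    qed
    moreover have "q j / (2 * real_of_int (q (Suc j))) \<le> \<bar>n\<bar> * \<bar>m - \<alpha> * n\<bar>"
    proof -
      have "1 / (2 * q (Suc j)) \<le> \<bar>m - \<alpha> * n\<bar>"
        using cop n(1) up \<alpha> grow by (rule denominators_lower_bound)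
      then have "real_of_int (q j) * (1 / (2 * q (Suc j))) \<le> \<bar>n\<bar> * \<bar>m - \<alpha> * n\<bar>"
        using lo X_ge_1[of "2 * Suc j + r"] by (intro mult_mono) (auto simp: q_def)
      then show ?thesis by simp
    qed
    ultimately show ?thesis unfolding qSuc by (auto simp: q_def)
  qed
  ultimately show ?thesis by (rule that)
qed

end

section \<open>Planar lattices given by two linear forms\<close>

lemma span_pair_real2:
  fixes u v :: "real ^ 2"
  assumes det: "u $ 1 * v $ 2 - u $ 2 * v $ 1 \<noteq> 0"
  shows "independent {u, v}" "span {u, v} = UNIV" "u \<noteq> v"
proof -
  show "u \<noteq> v" using det by auto
  show sp: "span {u, v} = UNIV"
  proof (rule UNIV_eq_I[symmetric])
    fix z :: "real ^ 2"
    define D where "D = u $ 1 * v $ 2 - u $ 2 * v $ 1"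
    have "D \<noteq> 0" using det by (simp add: D_def)
    \<comment> \<open>The coefficients are those of Cramer's rule.\<close>
    have "z = ((z $ 1 * v $ 2 - z $ 2 * v $ 1) / D) *\<^sub>R u + ((u $ 1 * z $ 2 - u $ 2 * z $ 1) / D) *\<^sub>R v"
      (is "z = ?w")
    proof -
      have "z $ 1 = ?w $ 1" "z $ 2 = ?w $ 2"
        using \<open>D \<noteq> 0\<close> by (simp_all add: field_simps) (simp_all add: D_def algebra_simps)
      then show ?thesis by (simp add: vec_eq_iff forall_2)
    qed
    also have "\<dots> \<in> span {u, v}"
      by (intro span_add span_mul span_base) auto
    finally show "z \<in> span {u, v}" .
  qed
  show "independent {u, v}"
    by (rule card_le_dim_spanning[where V = UNIV]) (use sp \<open>u \<noteq> v\<close> in \<open>auto simp: dim_UNIV\<close>)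
qed

text \<open>The lattice generated by (1, -\<beta>) and (-\<alpha>, 1), of determinant 1 -
  \<alpha>\<beta>. Good approximations to \<alpha> make the first coordinate small, those to \<beta>
  the second.\<close>

definition form_lattice :: "real \<Rightarrow> real \<Rightarrow> (real ^ 2) set" where
  "form_lattice \<alpha> \<beta> =
     {vector [real_of_int m - \<alpha> * real_of_int n, real_of_int n - \<beta> * real_of_int m] | m n. True}"

lemma full_rank_form_lattice:
  assumes "\<alpha> * \<beta> \<noteq> 1"
  shows "full_rank_lattice (form_lattice \<alpha> \<beta>)"
proof -
  define u v :: "real ^ 2" where "u = vector [1, - \<beta>]" and "v = vector [- \<alpha>, 1]"
  have "u $ 1 * v $ 2 - u $ 2 * v $ 1 \<noteq> 0"
    using assms by (simp add: u_def v_def mult.commute)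
  note uv = span_pair_real2[OF this]
  have comb: "vector [real_of_int m - \<alpha> * real_of_int n, real_of_int n - \<beta> * real_of_int m]
      = real_of_int m *\<^sub>R u + real_of_int n *\<^sub>R v" for m n
    by (simp add: vec_eq_iff forall_2 u_def v_def)
  have "form_lattice \<alpha> \<beta> = {\<Sum>b\<in>{u, v}. real_of_int (c b) *\<^sub>R b | c. True}"
  proof (intro equalityI subsetI)
    fix z assume "z \<in> form_lattice \<alpha> \<beta>"
    then obtain m n where z: "z = real_of_int m *\<^sub>R u + real_of_int n *\<^sub>R v"
      by (auto simp: form_lattice_def comb)
    define c where "c b = (if b = u then m else n)" for b
    have "z = (\<Sum>b\<in>{u, v}. real_of_int (c b) *\<^sub>R b)"
      using uv(3) by (simp add: z c_def)
    then show "z \<in> {\<Sum>b\<in>{u, v}. real_of_int (c b) *\<^sub>R b | c. True}" by blast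
  next
    fix z assume "z \<in> {\<Sum>b\<in>{u, v}. real_of_int (c b) *\<^sub>R b | c. True}"
    then show "z \<in> form_lattice \<alpha> \<beta>"
      using uv(3) by (auto simp: form_lattice_def comb)
  qed
  then show ?thesis
    unfolding full_rank_lattice_def using uv by blast
qed

section \<open>From boxes to lattice points\<close>

lemma geom_mean_abs_real2: "geom_mean_abs (l :: real ^ 2) = sqrt \<bar>l $ 1 * l $ 2\<bar>"
  by (simp add: geom_mean_abs_def UNIV_2 powr_half_sqrt real_sqrt_mult abs_mult)

lemma infnorm_real2_le: "infnorm (l :: real ^ 2) \<le> t \<longleftrightarrow> \<bar>l $ 1\<bar> \<le> t \<and> \<bar>l $ 2\<bar> \<le> t"
  by (simp add: infnorm_eq_Max UNIV_2)

lemma geom_mean_abs_le_powr: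
  "geom_mean_abs (l :: real ^ 2) \<le> t powr (- \<gamma>) \<longleftrightarrow> \<bar>l $ 1 * l $ 2\<bar> \<le> t powr (- 2 * \<gamma>)"
proof -
  have "t powr (- \<gamma>) = sqrt (t powr (- 2 * \<gamma>))"
    by (simp add: powr_half_sqrt[symmetric] powr_powr)
  then show ?thesis by (simp add: geom_mean_abs_real2)
qed

text \<open>The tightest box around a point has the absolute values of its coordinates as half
  sides. It is admissible unless a coordinate vanishes, since half sides must be positive.\<close>

lemma exists_box_iff:
  fixes \<Lambda> :: "(real ^ 2) set"
  assumes "t > 0"
  shows "(\<exists>l :: real ^ 2. (\<forall>i. 0 < l $ i) \<and> infnorm l \<le> t \<and> geom_mean_abs l \<le> t powr (- \<gamma>) \<and>
         (\<exists>z \<in> parallelepiped l \<inter> \<Lambda>. z \<noteq> 0)) \<longleftrightarrow>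
     (\<exists>z\<in>\<Lambda>. z \<noteq> 0 \<and> \<bar>z $ 1\<bar> \<le> t \<and> \<bar>z $ 2\<bar> \<le> t \<and> \<bar>z $ 1 * z $ 2\<bar> \<le> t powr (- 2 * \<gamma>))"
    (is "?L \<longleftrightarrow> ?R")
proof
  assume ?L
  then obtain l z :: "real ^ 2" where l: "0 < l $ 1" "0 < l $ 2" "\<bar>l $ 1\<bar> \<le> t" "\<bar>l $ 2\<bar> \<le> t"
      "\<bar>l $ 1 * l $ 2\<bar> \<le> t powr (- 2 * \<gamma>)"
    and z: "z \<in> \<Lambda>" "z \<noteq> 0" "\<bar>z $ 1\<bar> \<le> l $ 1" "\<bar>z $ 2\<bar> \<le> l $ 2"
    unfolding infnorm_real2_le geom_mean_abs_le_powr by (auto simp: parallelepiped_def forall_2)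
  have "\<bar>z $ 1 * z $ 2\<bar> \<le> \<bar>l $ 1 * l $ 2\<bar>"
    using z l unfolding abs_mult by (intro mult_mono) auto
  then show ?R using z l by (intro bexI[of _ z]) auto
next
  assume ?R
  then obtain z where z: "z \<in> \<Lambda>" "z \<noteq> 0" "\<bar>z $ 1\<bar> \<le> t" "\<bar>z $ 2\<bar> \<le> t"
    "\<bar>z $ 1 * z $ 2\<bar> \<le> t powr (- 2 * \<gamma>)" by auto
  define T where "T = t powr (- 2 * \<gamma>)"
  have "T > 0" using assms by (simp add: T_def)
  obtain x y where xy: "0 < x" "x \<le> t" "0 < y" "y \<le> t" "\<bar>z $ 1\<bar> \<le> x" "\<bar>z $ 2\<bar> \<le> y" "x * y \<le> T"
  proof -
    \<comment> \<open>Replacement for the half side at a vanishing coordinate, where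
      \<open>w\<close> is the other one: positive, at most \<open>t\<close>, and small enough for
      the product bound.\<close>
    have small: "0 < min t (T / \<bar>w\<bar>) \<and> min t (T / \<bar>w\<bar>) \<le> t \<and> \<bar>w\<bar> * min t (T / \<bar>w\<bar>) \<le> T"
      if "w \<noteq> 0" for w :: real
    proof -
      have "\<bar>w\<bar> * min t (T / \<bar>w\<bar>) \<le> \<bar>w\<bar> * (T / \<bar>w\<bar>)"
        by (intro mult_left_mono) auto
      then show ?thesis using that \<open>T > 0\<close> assms by simp
    qed
    consider "z $ 1 = 0" "z $ 2 \<noteq> 0" | "z $ 1 \<noteq> 0" "z $ 2 = 0" | "z $ 1 \<noteq> 0" "z $ 2 \<noteq> 0"
      using z(2) by (auto simp: vec_eq_iff forall_2)
    then show ?thesis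
    proof cases
      case 1
      then show ?thesis
        using small[of "z $ 2"] z \<open>T > 0\<close> by (intro that[of "min t (T / \<bar>z $ 2\<bar>)" "\<bar>z $ 2\<bar>"]) (auto simp: mult.commute)
    next
      case 2
      then show ?thesis
        using small[of "z $ 1"] z \<open>T > 0\<close> by (intro that[of "\<bar>z $ 1\<bar>" "min t (T / \<bar>z $ 1\<bar>)"]) auto
    next
      case 3
      then show ?thesis
        using z by (intro that[of "\<bar>z $ 1\<bar>" "\<bar>z $ 2\<bar>"]) (auto simp: T_def abs_mult)
    qed
  qed
  show ?L
    unfolding infnorm_real2_le geom_mean_abs_le_powr
    by (rule exI[of _ "vector [x, y]"])
      (use xy z in \<open>auto simp: forall_2 parallelepiped_def T_def intro!: bexI[of _ z]\<close>)
qed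

lemma weak_uniform_exponent_real2:
  fixes \<Lambda> :: "(real ^ 2) set"
  shows "weak_uniform_exponent \<Lambda> = Sup {ereal \<gamma> | \<gamma>. \<forall>\<^sub>F t in at_top. \<exists>z\<in>\<Lambda>. z \<noteq> 0 \<and>
     \<bar>z $ 1\<bar> \<le> t \<and> \<bar>z $ 2\<bar> \<le> t \<and> \<bar>z $ 1 * z $ 2\<bar> \<le> t powr (- 2 * \<gamma>)}"
proof -
  have "(\<forall>\<^sub>F t in at_top. \<exists>l :: real ^ 2. (\<forall>i. 0 < l $ i) \<and> infnorm l \<le> t \<and>
           geom_mean_abs l \<le> t powr (- \<gamma>) \<and> (\<exists>z \<in> parallelepiped l \<inter> \<Lambda>. z \<noteq> 0)) \<longleftrightarrow>
        (\<forall>\<^sub>F t in at_top. \<exists>z\<in>\<Lambda>. z \<noteq> 0 \<and>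
           \<bar>z $ 1\<bar> \<le> t \<and> \<bar>z $ 2\<bar> \<le> t \<and> \<bar>z $ 1 * z $ 2\<bar> \<le> t powr (- 2 * \<gamma>))" for \<gamma>
    by (intro eventually_cong[OF eventually_gt_at_top[of 0]] exists_box_iff)
  then show ?thesis unfolding weak_uniform_exponent_def by simp
qed

section \<open>Nonnegativity and the value infinity\<close>

text \<open>The exponent \<open>c\<close> itself need not be attained; working strictly below it
  leaves a positive power of \<open>t\<close> to absorb multiplicative constants.\<close>

lemma ereal_le_Sup_if_lt:
  assumes "\<And>x. x < c \<Longrightarrow> ereal x \<in> S"
  shows "ereal c \<le> Sup S"
proof (rule dense_le)
  fix y assume y: "y < ereal c"
  then obtain x where "y < ereal x" "ereal x < ereal c"
    using ereal_dense2 by blast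
  then show "y \<le> Sup S"
    using assms[of x] Sup_upper[of "ereal x" S] by auto
qed

lemma eventually_const_le_powr:
  assumes "c > (0 :: real)"
  shows "\<forall>\<^sub>F t in at_top. K \<le> t powr c"
  \<comment> \<open>The maximum with 1 keeps the base positive when \<open>K\<close> is not, so that
    the two powers cancel.\<close>
  using eventually_ge_at_top[of "max 1 K powr (1 / c)"]
proof eventually_elim
  case (elim t)
  have "(max 1 K powr (1 / c)) powr c \<le> t powr c"
    using elim assms by (intro powr_mono2) auto
  then show ?case using assms by (simp add: powr_powr)
qed

lemma weak_uniform_exponent_nonneg:
  fixes \<Lambda> :: "(real ^ 2) set"
  assumes "full_rank_lattice \<Lambda>"
  shows "0 \<le> weak_uniform_exponent \<Lambda>"
proof -
  obtain B where B: "independent B" "span B = UNIV"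
    and \<Lambda>: "\<Lambda> = {\<Sum>b\<in>B. real_of_int (c b) *\<^sub>R b | c. True}"
    using assms unfolding full_rank_lattice_def by blast
  have "finite B" using B(1) by (rule independent_imp_finite)
  have "B \<noteq> {}"
  proof
    assume "B = {}"
    then have "(vector [1, 1] :: real ^ 2) \<in> {0}" using B(2) by auto
    then show False by (simp add: vec_eq_iff forall_2)
  qed
  then obtain z where "z \<in> B" by blast
  then have "z \<noteq> 0" using B(1) dependent_zero by blast
  define c :: "real ^ 2 \<Rightarrow> int" where "c b = (if b = z then 1 else 0)" for b
  have "(\<Sum>b\<in>B. real_of_int (c b) *\<^sub>R b) = (\<Sum>b\<in>B. if b = z then b else 0)"
    by (rule sum.cong) (auto simp: c_def)
  then have "z = (\<Sum>b\<in>B. real_of_int (c b) *\<^sub>R b)"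
    using \<open>finite B\<close> \<open>z \<in> B\<close> by simp
  then have "z \<in> \<Lambda>" unfolding \<Lambda> by blast
  have "ereal 0 \<le> weak_uniform_exponent \<Lambda>"
    unfolding weak_uniform_exponent_real2
  proof (rule ereal_le_Sup_if_lt)
    fix x :: real assume "x < 0"
    then have "\<forall>\<^sub>F t in at_top. \<bar>z $ 1 * z $ 2\<bar> \<le> t powr (- 2 * x)"
      by (intro eventually_const_le_powr) simp
    then have "\<forall>\<^sub>F t in at_top. \<exists>z\<in>\<Lambda>. z \<noteq> 0 \<and>
       \<bar>z $ 1\<bar> \<le> t \<and> \<bar>z $ 2\<bar> \<le> t \<and> \<bar>z $ 1 * z $ 2\<bar> \<le> t powr (- 2 * x)"
      using eventually_ge_at_top[of "\<bar>z $ 1\<bar>"] eventually_ge_at_top[of "\<bar>z $ 2\<bar>"]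
    proof eventually_elim
      case (elim t)
      then show ?case using \<open>z \<in> \<Lambda>\<close> \<open>z \<noteq> 0\<close> by blast
    qed
    then show "ereal x \<in> {ereal \<gamma> | \<gamma>. \<forall>\<^sub>F t in at_top. \<exists>z\<in>\<Lambda>. z \<noteq> 0 \<and>
       \<bar>z $ 1\<bar> \<le> t \<and> \<bar>z $ 2\<bar> \<le> t \<and> \<bar>z $ 1 * z $ 2\<bar> \<le> t powr (- 2 * \<gamma>)}" by blast
  qed
  then show ?thesis by (simp add: zero_ereal_def)
qed

text \<open>This is the integer lattice, and its point (1, 0) has product 0.\<close>

lemma exponent_infinity: "weak_uniform_exponent (form_lattice 0 0) = \<infinity>"
proof -
  have "ereal x \<le> weak_uniform_exponent (form_lattice 0 0)" for x
    unfolding weak_uniform_exponent_real2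
  proof (rule Sup_upper)
    define e :: "real ^ 2" where "e = vector [1, 0]"
    have e: "e \<in> form_lattice 0 0"
      unfolding form_lattice_def e_def by (intro CollectI exI[of _ 1] exI[of _ 0]) simp
    have "\<forall>\<^sub>F t in at_top. \<exists>z\<in>form_lattice 0 0. z \<noteq> 0 \<and>
       \<bar>z $ 1\<bar> \<le> t \<and> \<bar>z $ 2\<bar> \<le> t \<and> \<bar>z $ 1 * z $ 2\<bar> \<le> t powr (- 2 * x)"
      using eventually_ge_at_top[of "1 :: real"]
      by eventually_elim (rule bexI[OF _ e], auto simp: e_def vec_eq_iff forall_2)
    then show "ereal x \<in> {ereal \<gamma> | \<gamma>. \<forall>\<^sub>F t in at_top. \<exists>z\<in>form_lattice 0 0. z \<noteq> 0 \<and>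
       \<bar>z $ 1\<bar> \<le> t \<and> \<bar>z $ 2\<bar> \<le> t \<and> \<bar>z $ 1 * z $ 2\<bar> \<le> t powr (- 2 * \<gamma>)}" by blast
  qed
  then show ?thesis by (rule ereal_top)
qed

section \<open>Lattices with a prescribed finite exponent\<close>

text \<open>Translates the size of a lattice point into the size of \<open>n\<close>, to which the
  approximation bounds refer. The hypotheses give 3/4 |m| <= 5/4 |n|, so subtracting \<beta>m from
  \<open>n\<close> loses at most 5/12 |n|.\<close>

lemma dominant_coefficient:
  fixes m n \<alpha> \<beta> :: real
  assumes "\<bar>\<alpha>\<bar> \<le> 1 / 4" "\<bar>\<beta>\<bar> \<le> 1 / 4" "\<bar>m - \<alpha> * n\<bar> \<le> \<bar>n - \<beta> * m\<bar>" "(m, n) \<noteq> (0, 0)"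
  shows "0 < \<bar>n\<bar>" "\<bar>n\<bar> \<le> 2 * \<bar>n - \<beta> * m\<bar>"
proof -
  have an: "\<bar>\<alpha> * n\<bar> \<le> 1 / 4 * \<bar>n\<bar>" and bm: "\<bar>\<beta> * m\<bar> \<le> 1 / 4 * \<bar>m\<bar>"
    unfolding abs_mult using assms by (intro mult_right_mono; simp)+
  then have m: "\<bar>m\<bar> \<le> 5 / 3 * \<bar>n\<bar>" using assms(3) by linarith
  then show "0 < \<bar>n\<bar>" using assms(4) by auto
  show "\<bar>n\<bar> \<le> 2 * \<bar>n - \<beta> * m\<bar>"
    using m bm abs_triangle_ineq2[of n "\<beta> * m"] abs_ge_zero[of n] by argo
qed

lemma exists_lattice_with_exponent:
  fixes \<gamma> :: real
  assumes "\<gamma> \<ge> 0"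
  shows "\<exists>\<Lambda> :: (real ^ 2) set. full_rank_lattice \<Lambda> \<and> weak_uniform_exponent \<Lambda> = ereal \<gamma>"
proof -
  \<comment> \<open>The ceiling produces the ratio of terms two apart that the exponent demands;
    adding 8 ensures the growth condition.\<close>
  define a where "a x = \<lceil>real_of_int x powr (2 * \<gamma>)\<rceil> + 8" for x :: int
  interpret interlaced_denominators a
  proof
    show "8 \<le> a x" if "x \<ge> 1" for x
      using powr_ge_zero[of x "2 * \<gamma>"] unfolding a_def by linarith
    show "a x \<le> a y" if "1 \<le> x" "x \<le> y" for x y
      using that assms by (auto simp: a_def intro!: ceiling_mono powr_mono2)
  qed
  have X_lower: "X k * X (Suc k) powr (2 * \<gamma>) \<le> X (k + 2)" for k
  proof -
    have "X k * X (Suc k) powr (2 * \<gamma>) \<le> real_of_int (X k) * a (X (Suc k))"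
      using X_ge_1[of k] unfolding a_def by (intro mult_left_mono) linarith+
    also have "\<dots> \<le> X (k + 2)"
      using X_bounds(1)[of k] by (simp add: mult.commute flip: of_int_mult)
    finally show ?thesis .
  qed
  \<comment> \<open>The 11 collects the main term, 1 for the ceiling, 8 from \<open>a\<close> and 1
    from \<open>X_bounds\<close>, each at most the power, which is at least 1.\<close>
  have X_upper: "X (k + 2) \<le> 11 * X k * X (Suc k) powr (2 * \<gamma>)" for k
  proof -
    have "1 \<le> X (Suc k) powr (2 * \<gamma>)"
      using X_ge_1[of "Suc k"] assms by (intro ge_one_powr_ge_zero) auto
    then have "real_of_int (a (X (Suc k)) + 1) \<le> 11 * X (Suc k) powr (2 * \<gamma>)"
      unfolding a_def by linarith
    then have "(a (X (Suc k)) + 1) * X k \<le> (11 * X (Suc k) powr (2 * \<gamma>)) * X k"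
      using X_ge_1[of k] unfolding of_int_mult by (intro mult_right_mono) auto
    moreover have "real_of_int (X (k + 2)) \<le> (a (X (Suc k)) + 1) * X k"
      using X_bounds(2)[of k] by (simp only: of_int_le_iff add_2_eq_Suc')
    ultimately show ?thesis by (simp add: mult_ac)
  qed
  obtain \<alpha> :: real where \<alpha>: "\<bar>\<alpha>\<bar> \<le> 1 / 4"
    "\<And>j. \<exists>p :: int. \<bar>p - \<alpha> * X (2 * j + 0)\<bar> \<le> 2 / X (2 * j + 0 + 2)"
    "\<And>(m :: int) (n :: int) k. 0 < \<bar>n\<bar> \<Longrightarrow> \<bar>n\<bar> < X (Suc k) \<Longrightarrow>
       \<exists>i\<le>k. X i / (2 * real_of_int (X (i + 2))) \<le> \<bar>n\<bar> * \<bar>m - \<alpha> * n\<bar>"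
    using approximable_number[of 0] by (metis zero_less_numeral)
  obtain \<beta> :: real where \<beta>: "\<bar>\<beta>\<bar> \<le> 1 / 4"
    "\<And>j. \<exists>p :: int. \<bar>p - \<beta> * X (2 * j + 1)\<bar> \<le> 2 / X (2 * j + 1 + 2)"
    "\<And>(m :: int) (n :: int) k. 0 < \<bar>n\<bar> \<Longrightarrow> \<bar>n\<bar> < X (Suc k) \<Longrightarrow>
       \<exists>i\<le>k. X i / (2 * real_of_int (X (i + 2))) \<le> \<bar>n\<bar> * \<bar>m - \<beta> * n\<bar>"
    using approximable_number[of 1] by (metis one_less_numeral_iff semiring_norm(76))
  let ?\<Lambda> = "form_lattice \<alpha> \<beta>"
  have "\<bar>\<alpha> * \<beta>\<bar> \<le> 1 / 4 * (1 / 4)"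
    unfolding abs_mult using \<alpha>(1) \<beta>(1) by (intro mult_mono) auto
  then have "\<alpha> * \<beta> \<noteq> 1" by auto
  then have full: "full_rank_lattice ?\<Lambda>" by (rule full_rank_form_lattice)

  \<comment> \<open>The pair (\<epsilon>, \<delta>) will be (\<alpha>, \<beta>) for even
    \<open>k\<close> and (\<beta>, \<alpha>) for odd \<open>k\<close>. One form is at most
    \<open>2 / X (k + 2)\<close>, the other at most \<open>2 * X k\<close>, and
    \<open>X_lower\<close> bounds the product.\<close>
  have good: "q - \<delta> * p \<noteq> 0 \<and> \<bar>q - \<delta> * p\<bar> \<le> 2 * X k \<and> \<bar>p - \<epsilon> * q\<bar> \<le> 2 * X k \<and>
      \<bar>p - \<epsilon> * q\<bar> * \<bar>q - \<delta> * p\<bar> \<le> 4 * X (Suc k) powr (- 2 * \<gamma>)"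
    if pq: "\<bar>p - \<epsilon> * q\<bar> \<le> 2 / X (k + 2)" "\<bar>\<epsilon>\<bar> \<le> 1 / 4" "\<bar>\<delta>\<bar> \<le> 1 / 4" "q = X k"
    for p q \<delta> \<epsilon> :: real and k
  proof -
    have "q \<ge> 1" using X_ge_1[of k] pq(4) by simp
    have X2: "real_of_int (X (k + 2)) \<ge> 8"
      using X_grow[of k] X_ge_1[of k] by simp
    have "2 / real_of_int (X (k + 2)) \<le> 1 / 4"
      using X2 by (simp add: field_simps)
    then have small: "\<bar>p - \<epsilon> * q\<bar> \<le> 1 / 4" using pq(1) by linarith
    have "\<bar>\<epsilon> * q\<bar> \<le> 1 / 4 * \<bar>q\<bar>" and dp: "\<bar>\<delta> * p\<bar> \<le> 1 / 4 * \<bar>p\<bar>"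
      unfolding abs_mult using pq by (intro mult_right_mono; simp)+
    then have "\<bar>p\<bar> \<le> q" using small \<open>q \<ge> 1\<close> by linarith
    then have size: "\<bar>q - \<delta> * p\<bar> \<le> 2 * q" using dp \<open>q \<ge> 1\<close> by linarith
    have "q - \<delta> * p \<noteq> 0" using \<open>\<bar>p\<bar> \<le> q\<close> dp \<open>q \<ge> 1\<close> by linarith
    have "\<bar>p - \<epsilon> * q\<bar> * \<bar>q - \<delta> * p\<bar> \<le> (2 / X (k + 2)) * (2 * q)"
      using pq(1) size X2 by (intro mult_mono) auto
    also have "\<dots> \<le> 4 * X (Suc k) powr (- 2 * \<gamma>)"
      using X_lower[of k] X2 X_ge_1[of "Suc k"]
      by (simp add: pq(4) powr_minus field_simps)
    finally show ?thesis using \<open>q - \<delta> * p \<noteq> 0\<close> size small \<open>q \<ge> 1\<close> pq(4) by auto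
  qed
  have good_point: "\<exists>z\<in>?\<Lambda>. z \<noteq> 0 \<and> \<bar>z $ 1\<bar> \<le> 2 * X k \<and> \<bar>z $ 2\<bar> \<le> 2 * X k \<and>
      \<bar>z $ 1 * z $ 2\<bar> \<le> 4 * X (Suc k) powr (- 2 * \<gamma>)" for k
  proof (cases "even k")
    case True
    then obtain j where "k = 2 * j + 0" by auto
    then obtain p :: int where p: "\<bar>p - \<alpha> * X k\<bar> \<le> 2 / X (k + 2)" using \<alpha>(2)[of j] by auto
    define z :: "real ^ 2" where "z = vector [p - \<alpha> * X k, X k - \<beta> * p]"
    have "z \<in> ?\<Lambda>" unfolding form_lattice_def z_def by blast
    moreover have "z \<noteq> 0"
      using good[OF p \<alpha>(1) \<beta>(1) refl] by (auto simp: z_def vec_eq_iff forall_2)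
    ultimately show ?thesis
      using good[OF p \<alpha>(1) \<beta>(1) refl] by (intro bexI[of _ z]) (auto simp: z_def abs_mult)
  next
    case False
    then obtain j where "k = 2 * j + 1" by (rule oddE)
    then obtain p :: int where p: "\<bar>p - \<beta> * X k\<bar> \<le> 2 / X (k + 2)" using \<beta>(2)[of j] by auto
    define z :: "real ^ 2" where "z = vector [X k - \<alpha> * p, p - \<beta> * X k]"
    have "z \<in> ?\<Lambda>" unfolding form_lattice_def z_def by blast
    moreover have "z \<noteq> 0"
      using good[OF p \<beta>(1) \<alpha>(1) refl] by (auto simp: z_def vec_eq_iff forall_2)
    ultimately show ?thesis
      using good[OF p \<beta>(1) \<alpha>(1) refl] by (intro bexI[of _ z]) (auto simp: z_def abs_mult mult.commute)
  qed

  have lower: "ereal \<gamma> \<le> weak_uniform_exponent ?\<Lambda>"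
    unfolding weak_uniform_exponent_real2
  proof (rule ereal_le_Sup_if_lt)
    fix x :: real assume "x < \<gamma>"
    \<comment> \<open>The constant is what remains of
      \<open>4 * X (Suc k) powr (- 2 * \<gamma>)\<close> once \<open>X (Suc k)\<close> is replaced
      by \<open>t / 2\<close>.\<close>
    have "\<forall>\<^sub>F t in at_top. 4 * 2 powr (2 * \<gamma>) \<le> t powr (2 * \<gamma> - 2 * x)"
      using \<open>x < \<gamma>\<close> by (intro eventually_const_le_powr) simp
    then have "\<forall>\<^sub>F t in at_top. \<exists>z\<in>?\<Lambda>. z \<noteq> 0 \<and>
       \<bar>z $ 1\<bar> \<le> t \<and> \<bar>z $ 2\<bar> \<le> t \<and> \<bar>z $ 1 * z $ 2\<bar> \<le> t powr (- 2 * x)"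
      using eventually_ge_at_top[of "2 :: real"]
    proof eventually_elim
      case (elim t)
      have ex: "\<exists>k. t < 2 * X (Suc k)"
      proof -
        obtain k where "t < real k" using reals_Archimedean2 by blast
        moreover have "real k \<le> 2 * X (Suc k)"
          using X_ge[of k] X_mono[of k "Suc k"] by linarith
        ultimately show ?thesis by (intro exI[of _ k]) linarith
      qed
      \<comment> \<open>The minimal \<open>k\<close> gives
        \<open>2 * X k \<le> t < 2 * X (Suc k)\<close>: the point of index \<open>k\<close> fits,
        and its product is controlled by the upper end of this range. For \<open>k = 0\<close> the
        lower end is the assumption that \<open>t\<close> is at least 2.\<close>
      define k where "k = (LEAST k. t < 2 * X (Suc k))"
      have up: "t < 2 * X (Suc k)"
        unfolding k_def using ex by (rule LeastI_ex)
      have lo: "2 * X k \<le> t"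
      proof (cases k)
        case 0
        then show ?thesis using elim(2) by simp
      next
        case (Suc l)
        then show ?thesis using not_less_Least[of l "\<lambda>k. t < 2 * X (Suc k)"] by (simp add: k_def)
      qed
      have "4 * X (Suc k) powr (- 2 * \<gamma>) \<le> 4 * (t / 2) powr (- 2 * \<gamma>)"
        using up elim(2) assms by (intro mult_left_mono powr_mono2') auto
      also have "\<dots> = (4 * 2 powr (2 * \<gamma>)) * t powr (- 2 * \<gamma>)"
        using elim(2) by (simp add: powr_divide powr_minus field_simps)
      also have "\<dots> \<le> t powr (2 * \<gamma> - 2 * x) * t powr (- 2 * \<gamma>)"
        using elim(1) by (intro mult_right_mono) auto
      also have "\<dots> = t powr (- 2 * x)"
        by (simp flip: powr_add)
      finally show ?case using good_point[of k] lo by force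
    qed
    then show "ereal x \<in> {ereal \<gamma> | \<gamma>. \<forall>\<^sub>F t in at_top. \<exists>z\<in>?\<Lambda>. z \<noteq> 0 \<and>
       \<bar>z $ 1\<bar> \<le> t \<and> \<bar>z $ 2\<bar> \<le> t \<and> \<bar>z $ 1 * z $ 2\<bar> \<le> t powr (- 2 * \<gamma>)}" by blast
  qed

  \<comment> \<open>Here \<epsilon>, \<delta> are again \<alpha>, \<beta> in either order, arranged
    so that the second form is the larger one. The size restriction forces |n| <
    \<open>X (Suc k)\<close>. In 44, the 11 comes from \<open>X_upper\<close>, one factor 2 from the
    approximation bound and the other from comparing |n| with the larger form.\<close>
  have bad: "1 / (44 * X (Suc k) powr (2 * \<gamma>)) \<le> \<bar>m - \<epsilon> * n\<bar> * \<bar>n - \<delta> * m\<bar>"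
    if \<epsilon>: "\<And>(m :: int) (n :: int) k. 0 < \<bar>n\<bar> \<Longrightarrow> \<bar>n\<bar> < X (Suc k) \<Longrightarrow>
       \<exists>i\<le>k. X i / (2 * real_of_int (X (i + 2))) \<le> \<bar>n\<bar> * \<bar>m - \<epsilon> * n\<bar>" "\<bar>\<epsilon>\<bar> \<le> 1 / 4" "\<bar>\<delta>\<bar> \<le> 1 / 4"
      and mn: "(m, n) \<noteq> (0, 0)" "\<bar>m - \<epsilon> * n\<bar> \<le> \<bar>n - \<delta> * m\<bar>" "\<bar>n - \<delta> * m\<bar> \<le> X (Suc k) / 4"
    for \<epsilon> \<delta> :: real and m n :: int and k
  proof -
    have n: "0 < \<bar>real_of_int n\<bar>" "\<bar>real_of_int n\<bar> \<le> 2 * \<bar>n - \<delta> * m\<bar>"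
      using dominant_coefficient[OF \<epsilon>(2,3) mn(2)] mn(1) by auto
    then have "\<bar>real_of_int n\<bar> < X (Suc k)"
      using order_trans[OF n(2) mult_left_mono[OF mn(3), of 2]] X_ge_1[of "Suc k"] by simp
    then have "0 < \<bar>n\<bar>" "\<bar>n\<bar> < X (Suc k)" using n by linarith+
    then obtain i where i: "i \<le> k" "X i / (2 * real_of_int (X (i + 2))) \<le> \<bar>n\<bar> * \<bar>m - \<epsilon> * n\<bar>"
      using \<epsilon>(1) by blast
    have "X (i + 2) \<le> 11 * X i * X (Suc k) powr (2 * \<gamma>)"
    proof -
      have "X (Suc i) powr (2 * \<gamma>) \<le> X (Suc k) powr (2 * \<gamma>)"
        using X_mono[of "Suc i" "Suc k"] i(1) X_ge_1[of "Suc i"] assms by (intro powr_mono2) auto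
      then have "11 * X i * X (Suc i) powr (2 * \<gamma>) \<le> 11 * X i * X (Suc k) powr (2 * \<gamma>)"
        using X_ge_1[of i] by (intro mult_left_mono) auto
      then show ?thesis using X_upper[of i] by linarith
    qed
    then have "1 / (22 * X (Suc k) powr (2 * \<gamma>)) \<le> X i / (2 * real_of_int (X (i + 2)))"
      using X_ge_1[of i] X_ge_1[of "i + 2"] X_ge_1[of "Suc k"] by (simp add: field_simps)
    also note i(2)
    also have "\<bar>n\<bar> * \<bar>m - \<epsilon> * n\<bar> \<le> (2 * \<bar>n - \<delta> * m\<bar>) * \<bar>m - \<epsilon> * n\<bar>"
      using n by (intro mult_right_mono) auto
    finally show ?thesis by (simp add: mult_ac)
  qed
  have upper: "weak_uniform_exponent ?\<Lambda> \<le> ereal \<gamma>"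
    unfolding weak_uniform_exponent_real2
  proof (rule Sup_least, clarify)
    fix x :: real
    assume ev: "\<forall>\<^sub>F t in at_top. \<exists>z\<in>?\<Lambda>. z \<noteq> 0 \<and>
       \<bar>z $ 1\<bar> \<le> t \<and> \<bar>z $ 2\<bar> \<le> t \<and> \<bar>z $ 1 * z $ 2\<bar> \<le> t powr (- 2 * x)"
    show "ereal x \<le> ereal \<gamma>"
    proof (rule ccontr)
      assume "\<not> ereal x \<le> ereal \<gamma>"
      \<comment> \<open>Any constant above the 44 of \<open>bad\<close> gives the strict
        contradiction; the power of 4 comes from \<open>X (Suc k) = 4 * t\<close>.\<close>
      then have "\<forall>\<^sub>F t in at_top. 45 * 4 powr (2 * \<gamma>) \<le> t powr (2 * x - 2 * \<gamma>)"
        by (intro eventually_const_le_powr) simp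
      from eventually_conj[OF ev this] obtain N where
        N: "\<And>t. t \<ge> N \<Longrightarrow> (\<exists>z\<in>?\<Lambda>. z \<noteq> 0 \<and>
            \<bar>z $ 1\<bar> \<le> t \<and> \<bar>z $ 2\<bar> \<le> t \<and> \<bar>z $ 1 * z $ 2\<bar> \<le> t powr (- 2 * x)) \<and>
            45 * 4 powr (2 * \<gamma>) \<le> t powr (2 * x - 2 * \<gamma>)"
        unfolding eventually_at_top_linorder by blast
      \<comment> \<open>The factor 8 combines the 2 of \<open>X_ge\<close> with the 4 in the
        definition of \<open>t\<close>.\<close>
      obtain k where k: "8 * N < real k" using reals_Archimedean2 by blast
      \<comment> \<open>The largest size that \<open>bad\<close> admits at index \<open>k\<close>,
        so that every nonzero lattice point within \<open>t\<close> has a large product.\<close>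
      define t where "t = X (Suc k) / 4"
      have "t > 0" using X_ge_1[of "Suc k"] by (simp add: t_def)
      have "real (Suc k) \<le> 2 * X (Suc k)"
        using X_ge[of "Suc k"] by linarith
      then have "t \<ge> N" using k unfolding t_def by simp
      from N[OF this] obtain z where z: "z \<in> ?\<Lambda>" "z \<noteq> 0" "\<bar>z $ 1\<bar> \<le> t" "\<bar>z $ 2\<bar> \<le> t"
        "\<bar>z $ 1 * z $ 2\<bar> \<le> t powr (- 2 * x)" and big: "45 * 4 powr (2 * \<gamma>) \<le> t powr (2 * x - 2 * \<gamma>)"
        by blast
      obtain m n :: int where mn: "z = vector [m - \<alpha> * n, n - \<beta> * m]"
        using z(1) unfolding form_lattice_def by blast
      have z12: "z $ 1 = m - \<alpha> * n" "z $ 2 = n - \<beta> * m" by (simp_all add: mn)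
      have nz: "(m, n) \<noteq> (0, 0)"
        using z(2) by (auto simp: mn vec_eq_iff forall_2)
      have "1 / (44 * X (Suc k) powr (2 * \<gamma>)) \<le> \<bar>z $ 1 * z $ 2\<bar>"
      proof (cases "\<bar>z $ 1\<bar> \<le> \<bar>z $ 2\<bar>")
        case True
        then show ?thesis
          using bad[OF \<alpha>(3,1) \<beta>(1) nz, of k] z(4) by (simp add: z12 t_def abs_mult)
      next
        case False
        \<comment> \<open>When the first form is the larger one, the roles of \<open>m\<close>,
          \<open>n\<close> and of \<alpha>, \<beta> are exchanged.\<close>
        have "(n, m) \<noteq> (0, 0)" using nz by auto
        then show ?thesis
          using False bad[OF \<beta>(3,1) \<alpha>(1), of n m k] z(3) by (simp add: z12 t_def abs_mult mult.commute)
      qed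
      also note z(5)
      also have "X (Suc k) powr (2 * \<gamma>) = 4 powr (2 * \<gamma>) * t powr (2 * \<gamma>)"
        using X_ge_1[of "Suc k"] by (simp add: t_def flip: powr_mult)
      finally have "t powr (2 * x) \<le> 44 * 4 powr (2 * \<gamma>) * t powr (2 * \<gamma>)"
        using \<open>t > 0\<close> by (simp add: powr_minus field_simps)
      then have "t powr (2 * x - 2 * \<gamma>) \<le> 44 * 4 powr (2 * \<gamma>)"
        using \<open>t > 0\<close> by (simp add: powr_diff field_simps)
      moreover have "(4 :: real) powr (2 * \<gamma>) > 0" by simp
      ultimately show False using big by linarith
    qed
  qed
  show ?thesis using full lower upper by (intro exI[of _ ?\<Lambda>]) auto
qed

section \<open>The set of all values\<close>

theorem theorem1:
  "{weak_uniform_exponent \<Lambda> | \<Lambda> :: (real ^ 2) set. full_rank_lattice \<Lambda>} = {0 .. \<infinity>}"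
proof (intro equalityI subsetI)
  fix w assume "w \<in> {weak_uniform_exponent \<Lambda> | \<Lambda> :: (real ^ 2) set. full_rank_lattice \<Lambda>}"
  then show "w \<in> {0 .. \<infinity>}" using weak_uniform_exponent_nonneg by auto
next
  fix w :: ereal assume w: "w \<in> {0 .. \<infinity>}"
  show "w \<in> {weak_uniform_exponent \<Lambda> | \<Lambda> :: (real ^ 2) set. full_rank_lattice \<Lambda>}"
  proof (cases w)
    case (real \<gamma>)
    then show ?thesis using exists_lattice_with_exponent[of \<gamma>] w by force
  next
    case PInf
    then show ?thesis
      using exponent_infinity full_rank_form_lattice[of 0 0] by force
  next
    case MInf
    then show ?thesis using w by simp
  qed
qed

end
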